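(* Let $\Delta\subset[0,1]^2$ be the open convex polygon with corners $(0,1),(1/2,1),(1/3,2/3),(0,1/2)$; let $\Delta'\subset\Delta$ be the open quadrilateral with vertices $(0,1/2),(5/24,2/3),(1/2,1),(0,1)$ and $\Delta''\subset\Delta$ the open quadrilateral with vertices $(0,1/2),(1/3,19/24),(1/2,1),(0,1)$. Let $\Delta_0\subset\Delta$ be an open convex set which is a dimension trap for the baker's map. Then either $\Delta'\subset\Delta_0$ or $\Delta''\subset\Delta_0$.
   Context: Let $X=[0,1]^2$. The baker's map is $B(x,y)=(2x,\frac y2)$ if $0\le x<\frac12$ and $B(x,y)=(2x-1,\frac{y+1}2)$ if $\frac12\le x<1$. For a bi-infinite sequence $u=(x_n)_{n\in\mathbb Z}\in\{0,1\}^{\mathbb Z}$, written $\dots x_{-1}x_0\cdot x_1x_2\dots$, put $\pi(u)=\left(\sum_{n\ge1}x_n2^{-n},\ \sum_{n\ge0}x_{-n}2^{-n-1}\right)$. The map $\pi$ conjugates the left shift $\sigma$ and $B$; points and sequences are used interchangeably, so the $B$-orbit of the point $\pi(u)$ is $(\pi(\sigma^n u))_{n\in\mathbb Z}$. For $H\subset X$ the survivor set is $\mathcal J(H)=\{(x,y)\in X: B^n(x,y)\notin H \text{ for all } n\in\mathbb Z\}$, i.e. $\mathcal J(H)=\{\pi(u): \pi(\sigma^nu)\notin H\ \text{for all } n\in\mathbb Z\}$. An open set $H$ is a dimension trap if $\dim_{\mathrm H}\mathcal J(H)=0$ (Hausdorff dimension). *)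

theory Defs
  imports "HOL-Analysis.Analysis"
begin

section \<open>Hausdorff measure and dimension\<close>

text \<open>
  The contribution \<open>diam(U)^s\<close> of a covering set. Since \<open>0 powr s = 0\<close> for every \<open>s\<close>, the case
  \<open>s = 0\<close> is treated separately, so that the 0-dimensional measure is the counting measure.
\<close>

definition diam_pow :: "real \<Rightarrow> 'a::metric_space set \<Rightarrow> ennreal" where
  "diam_pow s U =
     (if U = {} then 0 else if s = 0 then 1 else ennreal (diameter U powr s))"

text \<open>
  Boundedness is required of the covering sets because \<^const>\<open>diameter\<close> is unspecified on unbounded
  sets.
\<close>

definition hausdorff_premeasure :: "real \<Rightarrow> real \<Rightarrow> 'a::metric_space set \<Rightarrow> ennreal" where
  "hausdorff_premeasure s \<delta> A =
     (INF U \<in> {U :: nat \<Rightarrow> 'a set. A \<subseteq> (\<Union>i. U i) \<and> (\<forall>i. bounded (U i) \<and> diameter (U i) \<le> \<delta>)}.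
        \<Sum>i. diam_pow s (U i))"

definition hausdorff_measure :: "real \<Rightarrow> 'a::metric_space set \<Rightarrow> ennreal" where
  "hausdorff_measure s A = (SUP \<delta> \<in> {0<..}. hausdorff_premeasure s \<delta> A)"

definition hausdorff_dim :: "'a::metric_space set \<Rightarrow> ennreal" where
  "hausdorff_dim A = Inf {ennreal s | s. 0 \<le> s \<and> hausdorff_measure s A = 0}"


section \<open>The baker's map and its symbolic model\<close>

text \<open>
  Only the values on \<open>[0,1) \<times> [0,1]\<close> are meaningful.
\<close>

definition baker :: "real \<times> real \<Rightarrow> real \<times> real" where
  "baker = (\<lambda>(x, y). if x < 1/2 then (2 * x, y / 2) else (2 * x - 1, (y + 1) / 2))"

text \<open>
  A bi-infinite 0-1 sequence is a function \<open>int \<Rightarrow> bool\<close>, with \<^const>\<open>True\<close> standing for the digit 1.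
  Both series are indexed from 0, whence the shifted exponents.
\<close>

definition bpi :: "(int \<Rightarrow> bool) \<Rightarrow> real \<times> real" where
  "bpi u = ((\<Sum>n. of_bool (u (int n + 1)) / 2 ^ (n + 1)),
            (\<Sum>n. of_bool (u (- int n)) / 2 ^ (n + 1)))"

text \<open>\<open>shift n\<close> is the \<open>n\<close>-th power, \<open>n\<close> any integer, of the left shift.\<close>

definition shift :: "int \<Rightarrow> (int \<Rightarrow> bool) \<Rightarrow> (int \<Rightarrow> bool)" where
  "shift n u = (\<lambda>k. u (k + n))"

lemma summable_digits: "summable (\<lambda>n. of_bool (f n) / 2 ^ (n + 1) :: real)"
proof (rule summable_comparison_test)
  show "\<exists>N. \<forall>n\<ge>N. norm (of_bool (f n) / 2 ^ (n + 1) :: real) \<le> (1/2) ^ n"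
    by (auto simp: field_simps)
  show "summable (\<lambda>n. (1/2 :: real) ^ n)"
    by (rule summable_geometric) simp
qed

lemma digits_step:
  "(\<Sum>n. of_bool (f n) / 2 ^ (n + 1) :: real) =
     (of_bool (f 0) + (\<Sum>n. of_bool (f (Suc n)) / 2 ^ (n + 1))) / 2"
proof -
  have "(\<Sum>n. of_bool (f n) / 2 ^ (n + 1) :: real) =
          of_bool (f 0) / 2 + (\<Sum>n. of_bool (f (Suc n)) / 2 ^ (Suc n + 1))"
    using suminf_split_head[OF summable_digits[of f]] by simp
  also have "(\<Sum>n. of_bool (f (Suc n)) / 2 ^ (Suc n + 1) :: real) =
               (\<Sum>n. of_bool (f (Suc n)) / 2 ^ (n + 1)) / 2"
    using suminf_divide[OF summable_digits[of "\<lambda>n. f (Suc n)"], of 2] by (simp add: mult_ac)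
  finally show ?thesis by (simp add: add_divide_distrib)
qed

lemma digits_less_1:
  assumes "\<not> f m"
  shows "(\<Sum>n. of_bool (f n) / 2 ^ (n + 1) :: real) < 1"
proof -
  have g: "(\<lambda>n. 1 / 2 ^ (n + 1) :: real) sums 1"
    using power_half_series by (simp add: power_divide)
  have s: "summable (\<lambda>n. 1 / 2 ^ (n + 1) - of_bool (f n) / 2 ^ (n + 1) :: real)"
    using g summable_digits[of f] by (intro summable_diff) (auto simp: sums_iff)
  have "0 < (\<Sum>n. 1 / 2 ^ (n + 1) - of_bool (f n) / 2 ^ (n + 1) :: real)"
    by (rule suminf_pos2[OF s, of m]) (use assms in \<open>auto simp: field_simps\<close>)
  also have "\<dots> = 1 - (\<Sum>n. of_bool (f n) / 2 ^ (n + 1) :: real)"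
    using g suminf_diff[OF sums_summable[OF g] summable_digits[of f]]
    by (simp add: sums_iff)
  finally show ?thesis by simp
qed

lemma digits_nonneg: "0 \<le> (\<Sum>n. of_bool (f n) / 2 ^ (n + 1) :: real)"
  by (rule suminf_nonneg[OF summable_digits]) auto

text \<open>
  \<^const>\<open>bpi\<close> conjugates the left shift and the baker's map, apart from the usual ambiguity of dyadic
  expansions: it suffices that the digits from position 2 on are not all equal to 1.
\<close>

lemma bpi_shift:
  assumes "k \<ge> 2" "\<not> u k"
  shows "bpi (shift 1 u) = baker (bpi u)"
proof -
  define t :: real where "t = (\<Sum>n. of_bool (u (int n + 2)) / 2 ^ (n + 1))"
  have t0: "0 \<le> t" unfolding t_def by (rule digits_nonneg)
  have t1: "t < 1" unfolding t_def
    by (rule digits_less_1[of _ "nat (k - 2)"]) (use assms in auto)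
  have x: "fst (bpi u) = (of_bool (u 1) + t) / 2"
    using digits_step[of "\<lambda>n. u (int n + 1)"] by (simp add: bpi_def t_def add_ac)
  have y: "snd (bpi (shift 1 u)) = (of_bool (u 1) + snd (bpi u)) / 2"
    using digits_step[of "\<lambda>n. u (1 - int n)"] by (simp add: bpi_def shift_def)
  have x': "fst (bpi (shift 1 u)) = t"
    by (simp add: bpi_def shift_def t_def add_ac)
  show ?thesis
    using x y x' t0 t1 unfolding baker_def by (cases "u 1") (auto simp: prod_eq_iff split_beta)
qed

text \<open>
  The bi-infinite orbit of \<open>bpi u\<close> is \<open>bpi (shift n u)\<close>, \<open>n \<in> \<int>\<close>; a point having several codings
  survives as soon as one of its codings does.
\<close>

definition survivor :: "(real \<times> real) set \<Rightarrow> (real \<times> real) set" where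
  "survivor H = {bpi u | u. \<forall>n. bpi (shift n u) \<notin> H}"

definition dimension_trap :: "(real \<times> real) set \<Rightarrow> bool" where
  "dimension_trap H \<longleftrightarrow> open H \<and> hausdorff_dim (survivor H) = 0"


section \<open>The polygons\<close>

definition Delta :: "(real \<times> real) set" where
  "Delta = interior (convex hull {(0, 1), (1/2, 1), (1/3, 2/3), (0, 1/2)})"

definition Delta' :: "(real \<times> real) set" where
  "Delta' = interior (convex hull {(0, 1/2), (5/24, 2/3), (1/2, 1), (0, 1)})"

definition Delta'' :: "(real \<times> real) set" where
  "Delta'' = interior (convex hull {(0, 1/2), (1/3, 19/24), (1/2, 1), (0, 1)})"

end

(*
  A convex open set contains the interior of a convex polygon as soon as its closure contains the
  corners. If the closure of the trap H misses a point (or compact set) S, then H contains no point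
  sufficiently close to S, so H traps no sequence all of whose occurrences of 1.0 lie close to S;
  freely concatenating two blocks of this kind of equal length gives survivors of positive dimension.
  Blocks 0^a 1^b 0^c, with long runs, serve the corner (0,1); blocks with a single 1 or a single 0
  serve (0,1/2) and (1/2,1). For (5/24,2/3) and (1/3,19/24), which lie on one orbit homoclinic to the
  2-periodic point (1/3,2/3), take blocks (01)^j 0011 (01)^k: their points lie near the two segments
  joining (1/3,2/3) to these points. By convexity, a closure containing (0,1/2) and (1/2,1) that
  meets one of the segments contains its far endpoint.
*)

theory Submission
  imports Defs
begin

section \<open>A lower bound for the Hausdorff dimension\<close>

text \<open>Mass distribution with Lebesgue measure. Read as a function of \<open>P e\<close>,
  \<open>g e\<close> is Hoelder of exponent \<open>s\<close>, so a cover of \<open>A\<close> by sets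
  \<open>U i\<close> yields a cover of [0,1) by intervals of length 2 C diam(U i)^s; for t < s a
  cheap cover in dimension \<open>t\<close> would give total length below 1.\<close>

lemma hausdorff_dim_ge_Hoelder:
  fixes P :: "'b \<Rightarrow> 'a::metric_space" and g :: "'b \<Rightarrow> real"
  assumes s: "0 < s" and C: "0 < C"
    and sur: "{0..<1} \<subseteq> g ` E" and sub: "P ` E \<subseteq> A"
    and hoelder: "\<And>e e'. e \<in> E \<Longrightarrow> e' \<in> E \<Longrightarrow> \<bar>g e - g e'\<bar> \<le> C * dist (P e) (P e') powr s"
  shows "ennreal s \<le> hausdorff_dim A"
  unfolding hausdorff_dim_def
proof (rule Inf_greatest, clarify)
  fix t :: real assume t: "0 \<le> t" and ht: "hausdorff_measure t A = 0"
  have "s \<le> t"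
  proof (rule ccontr)
    assume "\<not> s \<le> t"
    then have ts: "t < s" by simp
    \<comment> \<open>Scale 1 is fine enough: a diameter at most 1 has its \<open>s\<close>-th power
      bounded by its \<open>t\<close>-th power.\<close>
    have "hausdorff_premeasure t 1 A \<le> hausdorff_measure t A"
      unfolding hausdorff_measure_def by (rule SUP_upper) auto
    then have "hausdorff_premeasure t 1 A < ennreal (1 / (2 * C))"
      using ht C by simp
    then obtain U where cov: "A \<subseteq> (\<Union>i. U i)" and bdd: "\<And>i. bounded (U i)"
      and d1: "\<And>i. diameter (U i) \<le> 1" and small: "(\<Sum>i. diam_pow t (U i)) < ennreal (1 / (2 * C))"
      unfolding hausdorff_premeasure_def INF_less_iff by auto
    \<comment> \<open>\<open>S i\<close> is a ball about one value \<open>g e\<close> with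
      \<open>P e\<close> in \<open>U i\<close>; by the Hoelder bound it contains the values of all
      parameters in \<open>E\<close> that \<open>P\<close> sends into \<open>U i\<close>.\<close>
    define S where "S i = (let e = SOME e. e \<in> E \<and> P e \<in> U i in
        if \<exists>e\<in>E. P e \<in> U i then cball (g e) (C * diameter (U i) powr s) else {})" for i
    have Sm: "emeasure lborel (S i) \<le> ennreal (2 * C) * diam_pow t (U i)" for i
    proof (cases "\<exists>e\<in>E. P e \<in> U i")
      case True
      then have ne: "U i \<noteq> {}" by auto
      have d0: "0 \<le> diameter (U i)" by (rule diameter_ge_0[OF bdd])
      obtain e where Se: "S i = cball e (C * diameter (U i) powr s)"
        using True by (auto simp: S_def Let_def)
      have "cball e r = {e - r..e + r}" for r
        by (auto simp: cball_def dist_real_def)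
      then have "emeasure lborel (S i) = ennreal (2 * C * diameter (U i) powr s)"
        using C by (simp add: Se)
      also have "\<dots> = ennreal (2 * C) * ennreal (diameter (U i) powr s)"
        using C by (simp add: ennreal_mult')
      also have "\<dots> \<le> ennreal (2 * C) * diam_pow t (U i)"
      proof (rule mult_left_mono)
        show "ennreal (diameter (U i) powr s) \<le> diam_pow t (U i)"
        proof (cases "t = 0")
          case True
          then show ?thesis
            using ne s d0 d1[of i] powr_mono2[of s "diameter (U i)" 1] by (simp add: diam_pow_def)
        next
          case False
          have "diameter (U i) powr s \<le> diameter (U i) powr t"
          proof (cases "diameter (U i) = 0")
            case False
            then show ?thesis using d0 d1[of i] ts t by (intro powr_mono') auto
          qed simp
          then show ?thesis using ne False by (simp add: diam_pow_def ennreal_leI)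
        qed
      qed simp
      finally show ?thesis .
    next
      case False
      then have "S i = {}" unfolding S_def Let_def by (simp only: if_False)
      then show ?thesis by simp
    qed
    have cover: "{0..<1} \<subseteq> (\<Union>i. S i)"
    proof
      fix x :: real assume "x \<in> {0..<1}"
      then obtain e where e: "e \<in> E" "x = g e" using sur by auto
      then have "P e \<in> A" using sub by auto
      then obtain i where i: "P e \<in> U i" using cov by auto
      define e' where "e' = (SOME e. e \<in> E \<and> P e \<in> U i)"
      have e': "e' \<in> E \<and> P e' \<in> U i"
        unfolding e'_def by (rule someI[of _ e]) (use e i in auto)
      have "dist (P e') (P e) \<le> diameter (U i)"
        using e' i by (intro diameter_bounded_bound bdd) auto
      then have "dist (P e') (P e) powr s \<le> diameter (U i) powr s"
        using s by (intro powr_mono2) auto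
      then have "C * dist (P e') (P e) powr s \<le> C * diameter (U i) powr s"
        using C by simp
      then have "dist (g e') x \<le> C * diameter (U i) powr s"
        using hoelder[of e' e] e e' by (simp add: dist_real_def)
      moreover have "S i = cball (g e') (C * diameter (U i) powr s)"
        using e i unfolding S_def e'_def[symmetric] Let_def by auto
      ultimately show "x \<in> (\<Union>i. S i)" by auto
    qed
    have borel: "S i \<in> sets lborel" for i
      by (auto simp: S_def Let_def)
    have "1 = emeasure lborel {0..<1::real}" by simp
    also have "\<dots> \<le> emeasure lborel (\<Union>i. S i)"
      using cover borel by (intro emeasure_mono sets.countable_UN) auto
    also have "\<dots> \<le> (\<Sum>i. emeasure lborel (S i))"
      using borel by (intro emeasure_subadditive_countably) auto
    also have "\<dots> \<le> (\<Sum>i. ennreal (2 * C) * diam_pow t (U i))"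
      by (intro suminf_le Sm) auto
    also have "\<dots> = ennreal (2 * C) * (\<Sum>i. diam_pow t (U i))"
      by simp
    also have "\<dots> < ennreal (2 * C) * ennreal (1 / (2 * C))"
      using small C by (intro ennreal_mult_strict_left_mono) auto
    also have "\<dots> = 1"
      using C by (simp flip: ennreal_mult)
    finally show False by simp
  qed
  then show "ennreal s \<le> ennreal t" by (rule ennreal_leI)
qed


section \<open>Binary expansions\<close>

definition dval :: "(nat \<Rightarrow> bool) \<Rightarrow> real" where
  "dval f = (\<Sum>n. of_bool (f n) / 2 ^ (n + 1))"

lemma bpi_eq_dval: "bpi u = (dval (\<lambda>i. u (int i + 1)), dval (\<lambda>i. u (- int i)))"
  by (simp add: bpi_def dval_def)

lemma dval_step: "dval f = (of_bool (f 0) + dval (\<lambda>n. f (Suc n))) / 2"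
  unfolding dval_def by (rule digits_step)

lemma dval_nonneg: "0 \<le> dval f"
  unfolding dval_def by (rule digits_nonneg)

lemma dval_not: "dval (\<lambda>n. \<not> f n) = 1 - dval f"
proof -
  have g: "(\<lambda>n. 1 / 2 ^ (n + 1) :: real) sums 1"
    using power_half_series by (simp add: power_divide)
  have "dval (\<lambda>n. \<not> f n) = (\<Sum>n. 1 / 2 ^ (n + 1) - of_bool (f n) / 2 ^ (n + 1))"
    unfolding dval_def by (rule suminf_cong) auto
  also have "\<dots> = 1 - dval f"
    using suminf_diff[OF sums_summable[OF g] summable_digits[of f]] g
    by (simp add: sums_iff dval_def)
  finally show ?thesis .
qed

lemma dval_le_1: "dval f \<le> 1"
  using dval_nonneg[of "\<lambda>n. \<not> f n"] by (simp add: dval_not)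

lemma dval_False [simp]: "dval (\<lambda>n. False) = 0"
  by (simp add: dval_def)

lemma dval_True [simp]: "dval (\<lambda>n. True) = 1"
  using dval_not[of "\<lambda>n. False"] by simp

section \<open>Common prefixes of digits and distance of values\<close>

lemma dval_common_prefix:
  assumes "\<And>i. i < m \<Longrightarrow> f i = g i"
  shows "dval f - dval g = (dval (\<lambda>n. f (m + n)) - dval (\<lambda>n. g (m + n))) / 2 ^ m"
  using assms
proof (induction m arbitrary: f g)
  case (Suc m)
  have "dval f - dval g = (dval (\<lambda>n. f (Suc n)) - dval (\<lambda>n. g (Suc n))) / 2"
    using Suc.prems[of 0] dval_step[of f] dval_step[of g] by simp
  also have "\<dots> = (dval (\<lambda>n. f (Suc (m + n))) - dval (\<lambda>n. g (Suc (m + n)))) / 2 ^ Suc m"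
    by (subst Suc.IH) (use Suc.prems in auto)
  finally show ?case by simp
qed simp

lemma dval_close:
  assumes "\<And>i. i < m \<Longrightarrow> f i = g i"
  shows "\<bar>dval f - dval g\<bar> \<le> 1 / 2 ^ m"
proof -
  have "\<bar>dval (\<lambda>n. f (m + n)) - dval (\<lambda>n. g (m + n))\<bar> \<le> 1"
    using dval_nonneg[of "\<lambda>n. f (m + n)"] dval_nonneg[of "\<lambda>n. g (m + n)"]
      dval_le_1[of "\<lambda>n. f (m + n)"] dval_le_1[of "\<lambda>n. g (m + n)"] by linarith
  then show ?thesis
    by (subst dval_common_prefix[OF assms]) (auto simp: field_simps)
qed

lemma dval_le_of_zero_digit:
  assumes "j < R" "\<not> f j"
  shows "dval f \<le> 1 - 1 / 2 ^ R"
  using assms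
proof (induction R arbitrary: f j)
  case (Suc R)
  show ?case
  proof (cases j)
    case 0
    have "(1::real) \<le> 2 ^ R" by simp
    then have "1 / 2 ^ Suc R \<le> (1 / 2 :: real)" by (simp add: field_simps)
    moreover have "dval f \<le> 1 / 2"
      using 0 Suc.prems dval_step[of f] dval_le_1[of "\<lambda>n. f (Suc n)"] by simp
    ultimately show ?thesis by linarith
  next
    case (Suc j')
    then have "dval (\<lambda>n. f (Suc n)) \<le> 1 - 1 / 2 ^ R"
      using Suc.prems by (intro Suc.IH) auto
    moreover have "(1 + (1 - 1 / 2 ^ R)) / 2 = (1 - 1 / 2 ^ Suc R :: real)"
      by (simp add: field_simps)
    moreover have "dval f \<le> (1 + dval (\<lambda>n. f (Suc n))) / 2"
      using dval_step[of f] by simp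
    ultimately show ?thesis by argo
  qed
qed simp

text \<open>A converse to \<open>dval_close\<close>. Zeros with gaps bounded by \<open>R\<close>
  exclude the ambiguity 0111... = 1000...: at the first difference, the tail starting with 1 is at
  least 1/2, while the one starting with 0 has another zero within \<open>R\<close> further digits
  and so stays 1 / 2^(R+1) below 1/2.\<close>

lemma dval_separated:
  assumes eq: "\<And>i. i < m \<Longrightarrow> f i = g i" and neq: "f m \<noteq> g m"
    and f: "\<And>i. \<exists>j<R. \<not> f (i + j)" and g: "\<And>i. \<exists>j<R. \<not> g (i + j)"
  shows "1 / 2 ^ (m + 1 + R) \<le> \<bar>dval f - dval g\<bar>"
proof -
  have main: "1 / 2 ^ (R + 1) \<le> dval f' - dval g'"
    if "f' 0" "\<not> g' 0" "j < R" "\<not> g' (Suc j)" for f' g' :: "nat \<Rightarrow> bool" and j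
  proof -
    have "dval f' \<ge> 1 / 2"
      using dval_step[of f'] dval_nonneg[of "\<lambda>n. f' (Suc n)"] that by simp
    moreover have "dval g' \<le> (1 - 1 / 2 ^ R) / 2"
      using dval_step[of g'] dval_le_of_zero_digit[of j R "\<lambda>n. g' (Suc n)"] that by simp
    moreover have "(1 - 1 / 2 ^ R) / 2 = 1 / 2 - (1 / 2 ^ (R + 1) :: real)"
      by (simp add: field_simps)
    ultimately show ?thesis by linarith
  qed
  obtain j where j: "j < R" "\<not> f (Suc m + j)" using f by blast
  obtain k where k: "k < R" "\<not> g (Suc m + k)" using g by blast
  have "1 / 2 ^ (R + 1) \<le> \<bar>dval (\<lambda>n. f (m + n)) - dval (\<lambda>n. g (m + n))\<bar>"
    using neq main[of "\<lambda>n. f (m + n)" "\<lambda>n. g (m + n)" k] main[of "\<lambda>n. g (m + n)" "\<lambda>n. f (m + n)" j] j k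
    by (cases "f m") auto
  then show ?thesis
    by (subst dval_common_prefix[OF eq]) (auto simp: field_simps power_add)
qed

lemma dval_surj:
  assumes "x \<in> {0..<1}"
  shows "\<exists>f. dval f = x"
proof -
  \<comment> \<open>These parities make the \<open>m\<close>-th partial sum equal to 2^m x rounded
    down and divided by 2^m.\<close>
  define f where "f n = odd \<lfloor>2 ^ (n + 1) * x\<rfloor>" for n
  have step: "\<lfloor>2 * y\<rfloor> = 2 * \<lfloor>y\<rfloor> + of_bool (odd \<lfloor>2 * y\<rfloor>)" for y :: real
  proof -
    have "\<lfloor>2 * y\<rfloor> = 2 * \<lfloor>y\<rfloor> \<or> \<lfloor>2 * y\<rfloor> = 2 * \<lfloor>y\<rfloor> + 1" by linarith
    then show ?thesis by (auto)
  qed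
  have part: "(\<Sum>n<m. of_bool (f n) / 2 ^ (n + 1)) = \<lfloor>2 ^ m * x\<rfloor> / 2 ^ m" for m
  proof (induction m)
    case 0
    have "\<lfloor>x\<rfloor> = 0" using assms by (auto simp: floor_eq_iff)
    then show ?case by simp
  next
    case (Suc m)
    have "real_of_int \<lfloor>2 ^ Suc m * x\<rfloor> = 2 * \<lfloor>2 ^ m * x\<rfloor> + of_bool (f m)"
      using step[of "2 ^ m * x"] unfolding f_def
      by (metis (no_types, lifting) Suc_eq_plus1 mult.assoc of_int_add of_int_mult of_int_numeral
          of_int_of_bool power_Suc)
    then show ?case using Suc by (simp add: field_simps)
  qed
  have "(\<lambda>m. \<lfloor>2 ^ m * x\<rfloor> / 2 ^ m) \<longlonglongrightarrow> x"
  proof (rule tendsto_sandwich[of "\<lambda>m. x - (1/2) ^ m" _ _ "\<lambda>m. x"])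
    show "\<forall>\<^sub>F m in sequentially. x - (1/2) ^ m \<le> \<lfloor>2 ^ m * x\<rfloor> / 2 ^ m"
    proof (rule always_eventually, rule allI)
      fix m
      have "2 ^ m * x - 1 \<le> \<lfloor>2 ^ m * x\<rfloor>" by linarith
      then have "(2 ^ m * x - 1) / 2 ^ m \<le> \<lfloor>2 ^ m * x\<rfloor> / 2 ^ m"
        by (intro divide_right_mono) auto
      then show "x - (1/2) ^ m \<le> \<lfloor>2 ^ m * x\<rfloor> / 2 ^ m"
        by (simp add: diff_divide_distrib power_divide)
    qed
    show "\<forall>\<^sub>F m in sequentially. \<lfloor>2 ^ m * x\<rfloor> / 2 ^ m \<le> x"
    proof (rule always_eventually, rule allI)
      fix m
      have "\<lfloor>2 ^ m * x\<rfloor> \<le> 2 ^ m * x" by linarith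
      then show "\<lfloor>2 ^ m * x\<rfloor> / 2 ^ m \<le> x" by (simp add: field_simps)
    qed
    have "(\<lambda>m. x - (1/2) ^ m) \<longlonglongrightarrow> x - 0"
      by (intro tendsto_intros LIMSEQ_power_zero) simp
    then show "(\<lambda>m. x - (1/2) ^ m) \<longlonglongrightarrow> x" by simp
  qed simp
  then have "(\<lambda>n. of_bool (f n) / 2 ^ (n + 1)) sums x"
    unfolding sums_def part .
  then show ?thesis by (auto simp: dval_def sums_iff)
qed


section \<open>Survivor sets containing a full shift on two blocks\<close>

text \<open>\<open>b\<close> selects, for every integer index, one of two words of length
  \<open>L\<close>; \<open>w c r\<close> is letter \<open>r\<close> of word \<open>c\<close>. As
  \<open>div\<close> and \<open>mod\<close> on integers round down, negative positions need no
  separate treatment.\<close>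

definition blocks :: "nat \<Rightarrow> (bool \<Rightarrow> nat \<Rightarrow> bool) \<Rightarrow> (int \<Rightarrow> bool) \<Rightarrow> int \<Rightarrow> bool" where
  "blocks L w b k = w (b (k div int L)) (nat (k mod int L))"

lemma blocks_at:
  assumes "k = int L * q + int r" "r < L"
  shows "blocks L w b k = w (b q) r"
proof -
  have "k div int L = q" "k mod int L = int r"
    using assms by auto
  then show ?thesis by (simp add: blocks_def)
qed

lemma block_pos:
  assumes "0 < L"
  obtains q r where "k = int L * q + int r" "r < L"
proof
  show "k = int L * (k div int L) + int (nat (k mod int L))" using assms by simp
  show "nat (k mod int L) < L" using assms by (simp add: nat_less_iff)
qed

lemma shift_shift: "shift n (shift m u) = shift (n + m) u"
  by (simp add: shift_def fun_eq_iff add_ac)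

text \<open>One free binary choice per \<open>L\<close> digits gives dimension at least 1/L:
  recovering the choices from the first coordinate is Hoelder of exponent 1/L. The zero in each word
  bounds the gaps between zeros, as \<open>dval_separated\<close> requires.\<close>

lemma survivor_blocks_dim:
  assumes L: "0 < L" and neq: "\<exists>r<L. w True r \<noteq> w False r" and zero: "\<And>c. \<exists>r<L. \<not> w c r"
    and surv: "\<And>b n. bpi (shift n (blocks L w b)) \<notin> H"
  shows "hausdorff_dim (survivor H) \<noteq> 0"
proof -
  \<comment> \<open>Only blocks of nonnegative index carry free choices; \<open>nat\<close> gives
    all earlier blocks the choice \<open>e 0\<close>. The shift by -1 makes the first coordinate
    start with the first letter of block 0.\<close>
  define u where "u e = shift (-1) (blocks L w (\<lambda>i. e (nat i)))" for e :: "nat \<Rightarrow> bool"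
  define a where "a e n = blocks L w (\<lambda>i. e (nat i)) (int n)" for e :: "nat \<Rightarrow> bool" and n
  have fst_u: "fst (bpi (u e)) = dval (a e)" for e
    by (simp add: bpi_eq_dval u_def a_def[abs_def] shift_def)
  have a_at: "a e (L * q + r) = w (e q) r" if "r < L" for e q r
    unfolding a_def using blocks_at[of "int (L * q + r)" L "int q" r] that by simp
  \<comment> \<open>The zero of the next block is less than 2 L places ahead.\<close>
  have a_zero: "\<exists>j<2*L. \<not> a e (i + j)" for e i
  proof -
    obtain r where r: "r < L" "\<not> w (e (Suc (i div L))) r" using zero by blast
    have lt: "i mod L < L" using L by simp
    have i: "i = L * (i div L) + i mod L" by simp
    have "L * Suc (i div L) + r = i + (L - i mod L + r)"
      using lt i unfolding mult_Suc_right by linarith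
    then have "\<not> a e (i + (L - i mod L + r))" using a_at[of r e "Suc (i div L)"] r by metis
    moreover have "L - i mod L + r < 2 * L" using r(1) by linarith
    ultimately show ?thesis by blast
  qed
  \<comment> \<open>If \<open>e\<close> and \<open>e'\<close> first differ at \<open>i\<close>,
    their digits first differ at some m < L (i + 1), so the points are at least 2^(-L (i+3)) apart.
    The power 1/L of this is 2^(-i) / 8, whence the constant 8.\<close>
  have hoelder: "\<bar>dval e - dval e'\<bar> \<le> 8 * dist (bpi (u e)) (bpi (u e')) powr (1 / L)" for e e'
  proof (cases "e = e'")
    case False
    define i where "i = (LEAST i. e i \<noteq> e' i)"
    have ei: "e i \<noteq> e' i" unfolding i_def by (rule LeastI_ex) (use False in auto)
    have eq: "e k = e' k" if "k < i" for k using that not_less_Least unfolding i_def by blast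
    have ex: "\<exists>m. a e m \<noteq> a e' m"
    proof -
      obtain r where "r < L" "w True r \<noteq> w False r" using neq by blast
      then have "a e (L * i + r) \<noteq> a e' (L * i + r)"
        using ei a_at by (cases "e i") auto
      then show ?thesis ..
    qed
    define m where "m = (LEAST m. a e m \<noteq> a e' m)"
    have am: "a e m \<noteq> a e' m" unfolding m_def by (rule LeastI_ex[OF ex])
    have aeq: "a e k = a e' k" if "k < m" for k using that not_less_Least unfolding m_def by blast
    have "m < L * i + L"
    proof -
      obtain r where r: "r < L" "w True r \<noteq> w False r" using neq by blast
      then have "a e (L * i + r) \<noteq> a e' (L * i + r)"
        using ei a_at by (cases "e i") auto
      then have "m \<le> L * i + r" unfolding m_def by (rule Least_le)
      then show ?thesis using r by simp
    qed
    then have "m + 1 + 2 * L \<le> L * (i + 3)" by (simp add: algebra_simps)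
    then have "1 / 2 ^ (L * (i + 3)) \<le> (1 / 2 ^ (m + 1 + 2 * L) :: real)"
      by (intro divide_left_mono power_increasing) auto
    also have "\<dots> \<le> \<bar>dval (a e) - dval (a e')\<bar>"
      by (rule dval_separated) (use aeq am a_zero in auto)
    also have "\<dots> \<le> dist (bpi (u e)) (bpi (u e'))"
      using dist_fst_le[of "bpi (u e)" "bpi (u e')"] by (simp add: fst_u dist_real_def)
    finally have "(1 / 2 ^ (L * (i + 3))) powr (1 / L) \<le> dist (bpi (u e)) (bpi (u e')) powr (1 / L)"
      by (intro powr_mono2) auto
    moreover have "(1 / 2 ^ (L * (i + 3)) :: real) powr (1 / L) = 1 / 2 ^ (i + 3)"
    proof -
      have "(1 / 2 ^ (L * (i + 3)) :: real) = 2 powr (- real (L * (i + 3)))"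
        by (simp only: powr_minus powr_realpow zero_less_numeral inverse_eq_divide)
      then have "(1 / 2 ^ (L * (i + 3)) :: real) powr (1 / L) = 2 powr (- real (i + 3))"
        using L by (simp add: powr_powr)
      then show ?thesis
        by (simp only: powr_minus powr_realpow zero_less_numeral inverse_eq_divide)
    qed
    moreover have "\<bar>dval e - dval e'\<bar> \<le> 1 / 2 ^ i"
      by (rule dval_close) (use eq in auto)
    ultimately show ?thesis by (simp add: power_add)
  qed simp
  have "ennreal (1 / L) \<le> hausdorff_dim (survivor H)"
  proof (rule hausdorff_dim_ge_Hoelder[where P = "\<lambda>e. bpi (u e)" and g = dval and E = UNIV and C = 8])
    show "{0..<1} \<subseteq> range dval" using dval_surj by blast
    show "range (\<lambda>e. bpi (u e)) \<subseteq> survivor H"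
      using surv by (auto simp: survivor_def u_def shift_shift)
  qed (use L hoelder in auto)
  moreover have "0 < ennreal (1 / L)" using L by simp
  ultimately show ?thesis by auto
qed

section \<open>Occurrences of 1.0 and points near a compact set\<close>

lemma bpi_shift_eq:
  "bpi (shift n u) = (dval (\<lambda>i. u (n + 1 + int i)), dval (\<lambda>i. u (n - int i)))"
  by (simp add: bpi_eq_dval shift_def add_ac)

text \<open>Strictness of the bounds decides the digits beside the point: a first digit 1 makes the
  value at least 1/2, a first digit 0 makes it at most 1/2. Hence only occurrences of 1.0 can enter
  the hole.\<close>

lemma bpi_shift_in_box:
  assumes "bpi (shift n u) \<in> {0<..<1/2} \<times> {1/2<..<1}"
  shows "u n" "\<not> u (n + 1)"
proof -
  have "dval (\<lambda>i. u (n + 1 + int i)) < 1/2" "1/2 < dval (\<lambda>i. u (n - int i))"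
    using assms by (auto simp: bpi_shift_eq)
  then show "u n" "\<not> u (n + 1)"
    using dval_step[of "\<lambda>i. u (n + 1 + int i)"] dval_step[of "\<lambda>i. u (n - int i)"]
      dval_nonneg[of "\<lambda>i. u (n + 1 + int (Suc i))"] dval_le_1[of "\<lambda>i. u (n - int (Suc i))"]
    by (cases "u n"; cases "u (n + 1)"; simp)+
qed

lemma far_from_compact:
  fixes H S :: "(real \<times> real) set"
  assumes "compact S" "S \<inter> closure H = {}"
  obtains N :: nat where
    "\<And>p s. p \<in> H \<Longrightarrow> s \<in> S \<Longrightarrow> \<bar>fst p - fst s\<bar> \<le> 1 / 2 ^ N \<Longrightarrow> \<bar>snd p - snd s\<bar> \<le> 1 / 2 ^ N \<Longrightarrow> False"
proof -
  obtain d where d: "0 < d" "\<And>s p. s \<in> S \<Longrightarrow> p \<in> closure H \<Longrightarrow> d \<le> dist s p"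
    using separate_compact_closed[OF assms(1) closed_closure assms(2)] by blast
  obtain N where N: "(1/2) ^ N < d / 2"
    using real_arch_pow_inv[of "d / 2" "1/2"] d by auto
  show ?thesis
  proof
    fix p s assume *: "p \<in> H" "s \<in> S" "\<bar>fst p - fst s\<bar> \<le> 1 / 2 ^ N" "\<bar>snd p - snd s\<bar> \<le> 1 / 2 ^ N"
    have "dist s p \<le> \<bar>fst s - fst p\<bar> + \<bar>snd s - snd p\<bar>"
      using sqrt_sum_squares_le_sum_abs[of "fst s - fst p" "snd s - snd p"]
      by (simp add: dist_prod_def dist_real_def)
    also have "\<dots> < d" using * N by (simp add: power_divide)
    finally show False using d(2)[of s p] * closure_subset[of H] by auto
  qed
qed

text \<open>Compactness gives a uniform distance between \<open>S\<close> and \<open>H\<close>,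
  hence a number \<open>N\<close> of digits such that agreement on \<open>N\<close> digits to each
  side with a coding of a point of \<open>S\<close> keeps a point out of \<open>H\<close>. Since
  \<open>N\<close> depends on \<open>H\<close>, a pair of words is needed for every
  \<open>N\<close>.\<close>

lemma survivor_near_compact_dim:
  assumes box: "H \<subseteq> {0<..<1/2} \<times> {1/2<..<1}"
    and S: "compact S" "S \<inter> closure H = {}"
    and L: "\<And>N. 0 < L N" "\<And>N. \<exists>r<L N. w N True r \<noteq> w N False r"
      "\<And>N c. \<exists>r<L N. \<not> w N c r"
    and near: "\<And>N b n u. u = blocks (L N) (w N) b \<Longrightarrow> u n \<Longrightarrow> \<not> u (n + 1) \<Longrightarrow>
      \<exists>f g. (dval f, dval g) \<in> S \<and> (\<forall>i<N. u (n + 1 + int i) = f i \<and> u (n - int i) = g i)"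
  shows "hausdorff_dim (survivor H) \<noteq> 0"
proof -
  obtain N :: nat where N: "\<And>p s. p \<in> H \<Longrightarrow> s \<in> S \<Longrightarrow> \<bar>fst p - fst s\<bar> \<le> 1 / 2 ^ N \<Longrightarrow>
      \<bar>snd p - snd s\<bar> \<le> 1 / 2 ^ N \<Longrightarrow> False"
    using far_from_compact[OF S] by blast
  show ?thesis
  proof (rule survivor_blocks_dim[OF L])
    fix b n
    define u where "u = blocks (L N) (w N) b"
    show "bpi (shift n (blocks (L N) (w N) b)) \<notin> H"
    proof
      assume "bpi (shift n (blocks (L N) (w N) b)) \<in> H"
      then have inH: "bpi (shift n u) \<in> H" by (simp add: u_def)
      then have "u n" "\<not> u (n + 1)" using box bpi_shift_in_box by blast+
      then obtain f g where fg: "(dval f, dval g) \<in> S"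
        "\<forall>i<N. u (n + 1 + int i) = f i \<and> u (n - int i) = g i"
        using near[OF u_def] by blast
      show False
        by (rule N[OF inH fg(1)]; unfold bpi_shift_eq fst_conv snd_conv; rule dval_close)
          (use fg(2) in auto)
    qed
  qed
qed


section \<open>The corners of the hole\<close>

lemma corner_0_1:
  assumes box: "H \<subseteq> {0<..<1/2} \<times> {1/2<..<1}" and dim: "hausdorff_dim (survivor H) = 0"
  shows "(0, 1) \<in> closure H"
proof (rule ccontr)
  assume "(0, 1) \<notin> closure H"
  then have "{(0, 1)} \<inter> closure H = {}" by auto
  \<comment> \<open>The words are 0^N 1^N 0^(N+2) and 0^N 1^(N+1) 0^(N+1); the windows of
    \<open>N\<close> digits on both sides of 1.0 stay inside one block.\<close>
  note * = survivor_near_compact_dim[OF box _ this, where L = "\<lambda>N. 3 * N + 2" and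
      w = "\<lambda>N c r. N \<le> r \<and> r < 2 * N + of_bool c"]
  have "hausdorff_dim (survivor H) \<noteq> 0"
  proof (rule *)
    fix N :: nat
    show "\<exists>r<3*N+2. (N \<le> r \<and> r < 2 * N + of_bool True) \<noteq> (N \<le> r \<and> r < 2 * N + of_bool False)"
      by (rule exI[of _ "2 * N"]) auto
    show "\<exists>r<3*N+2. \<not> (N \<le> r \<and> r < 2 * N + of_bool c)" for c
      by (rule exI[of _ "3 * N + 1"]) auto
    fix b :: "int \<Rightarrow> bool" and n u
    assume u: "u = blocks (3 * N + 2) (\<lambda>c r. N \<le> r \<and> r < 2 * N + of_bool c) b"
      and un: "u n" "\<not> u (n + 1)"
    obtain q r where qr: "n = int (3 * N + 2) * q + int r" "r < 3 * N + 2"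
      using block_pos[of "3 * N + 2"] by (metis add_gr_0 zero_less_numeral)
    have at: "u k = (N \<le> r' \<and> r' < 2 * N + of_bool (b q))"
      if "k = int (3 * N + 2) * q + int r'" "r' < 3 * N + 2" for k r'
      unfolding u by (rule blocks_at[OF that])
    have r1: "N \<le> r" "r < 2 * N + of_bool (b q)" using at[OF qr] un by auto
    \<comment> \<open>The digit after \<open>n\<close> is 0, so \<open>r\<close> is the last place
      of the run of ones.\<close>
    have r2: "r + 1 = 2 * N + of_bool (b q)"
      using at[of "n + 1" "r + 1"] r1 un qr by (cases "b q") auto
    show "\<exists>f g. (dval f, dval g) \<in> {(0, 1)} \<and> (\<forall>i<N. u (n + 1 + int i) = f i \<and> u (n - int i) = g i)"
    proof (intro exI conjI allI impI)
      fix i assume i: "i < N"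
      show "u (n + 1 + int i) = False"
        by (subst at[of _ "r + 1 + i"]) (use i r2 qr(1) in \<open>cases "b q"; auto\<close>)+
      show "u (n - int i) = True"
        by (subst at[of _ "r - i"]) (use i r2 qr(1) in \<open>cases "b q"; auto simp: of_nat_diff\<close>)+
    qed simp
  qed auto
  with dim show False by simp
qed

lemma corner_0_half:
  assumes box: "H \<subseteq> {0<..<1/2} \<times> {1/2<..<1}" and dim: "hausdorff_dim (survivor H) = 0"
  shows "(0, 1/2) \<in> closure H"
proof (rule ccontr)
  assume "(0, 1/2) \<notin> closure H"
  then have "{(0, 1/2)} \<inter> closure H = {}" by auto
  \<comment> \<open>A single 1 at place \<open>N\<close> or N+1, with at least \<open>N\<close>
    zeros of the same block on either side; the limit point has coding ...0001.000...\<close>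
  note * = survivor_near_compact_dim[OF box _ this, where L = "\<lambda>N. 2 * N + 3" and
      w = "\<lambda>N c r. r = N + of_bool c"]
  have "hausdorff_dim (survivor H) \<noteq> 0"
  proof (rule *)
    fix N :: nat
    show "\<exists>r<2*N+3. (r = N + of_bool True) \<noteq> (r = N + of_bool False)"
      by (rule exI[of _ N]) auto
    show "\<exists>r<2*N+3. \<not> (r = N + of_bool c)" for c
      by (rule exI[of _ "2 * N + 2"]) auto
    fix b :: "int \<Rightarrow> bool" and n u
    assume u: "u = blocks (2 * N + 3) (\<lambda>c r. r = N + of_bool c) b"
      and un: "u n" "\<not> u (n + 1)"
    obtain q r where qr: "n = int (2 * N + 3) * q + int r" "r < 2 * N + 3"
      using block_pos[of "2 * N + 3"] by (metis add_gr_0 zero_less_numeral)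
    have at: "u k = (r' = N + of_bool (b q))"
      if "k = int (2 * N + 3) * q + int r'" "r' < 2 * N + 3" for k r'
      unfolding u by (rule blocks_at[OF that])
    have r: "r = N + of_bool (b q)" using at[OF qr] un by auto
    show "\<exists>f g. (dval f, dval g) \<in> {(0, 1/2)} \<and> (\<forall>i<N. u (n + 1 + int i) = f i \<and> u (n - int i) = g i)"
    proof (intro exI conjI allI impI)
      show "(dval (\<lambda>i. False), dval (\<lambda>i. i = 0)) \<in> {(0, 1/2)}"
        by (subst (2) dval_step) simp
      fix i assume i: "i < N"
      show "u (n + 1 + int i) = False"
        by (subst at[of _ "r + 1 + i"]) (use i r qr(1) in \<open>cases "b q"; auto\<close>)+
      show "u (n - int i) = (i = 0)"
        by (subst at[of _ "r - i"]) (use i r qr(1) in \<open>cases "b q"; auto simp: of_nat_diff\<close>)+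
    qed
  qed auto
  with dim show False by simp
qed

lemma corner_half_1:
  assumes box: "H \<subseteq> {0<..<1/2} \<times> {1/2<..<1}" and dim: "hausdorff_dim (survivor H) = 0"
  shows "(1/2, 1) \<in> closure H"
proof (rule ccontr)
  assume "(1/2, 1) \<notin> closure H"
  then have "{(1/2, 1)} \<inter> closure H = {}" by auto
  \<comment> \<open>The complementary words, with a single 0, and limit coding ...111.0111... The
    block is now located through the 0, at n+1 instead of \<open>n\<close>.\<close>
  note * = survivor_near_compact_dim[OF box _ this, where L = "\<lambda>N. 2 * N + 3" and
      w = "\<lambda>N c r. r \<noteq> N + of_bool c"]
  have "hausdorff_dim (survivor H) \<noteq> 0"
  proof (rule *)
    fix N :: nat
    show "\<exists>r<2*N+3. (r \<noteq> N + of_bool True) \<noteq> (r \<noteq> N + of_bool False)"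
      by (rule exI[of _ N]) auto
    show "\<exists>r<2*N+3. \<not> (r \<noteq> N + of_bool c)" for c
      by (rule exI[of _ "N + of_bool c"]) (cases c; auto)
    fix b :: "int \<Rightarrow> bool" and n u
    assume u: "u = blocks (2 * N + 3) (\<lambda>c r. r \<noteq> N + of_bool c) b"
      and un: "u n" "\<not> u (n + 1)"
    obtain q r where qr: "n + 1 = int (2 * N + 3) * q + int r" "r < 2 * N + 3"
      using block_pos[of "2 * N + 3"] by (metis add_gr_0 zero_less_numeral)
    have at: "u k = (r' \<noteq> N + of_bool (b q))"
      if "k = int (2 * N + 3) * q + int r'" "r' < 2 * N + 3" for k r'
      unfolding u by (rule blocks_at[OF that])
    have r: "r = N + of_bool (b q)" using at[OF qr] un by auto
    show "\<exists>f g. (dval f, dval g) \<in> {(1/2, 1)} \<and> (\<forall>i<N. u (n + 1 + int i) = f i \<and> u (n - int i) = g i)"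
    proof (intro exI conjI allI impI)
      show "(dval (\<lambda>i. i \<noteq> 0), dval (\<lambda>i. True)) \<in> {(1/2, 1)}"
        by (subst (1) dval_step) simp
      fix i assume i: "i < N"
      show "u (n + 1 + int i) = (i \<noteq> 0)"
        by (subst at[of _ "r + i"]) (use i r qr(1) in \<open>cases "b q"; auto\<close>)+
      show "u (n - int i) = True"
        by (subst at[of _ "r - 1 - i"]) (use i r qr(1) in \<open>cases "b q"; auto simp: of_nat_diff\<close>)+
    qed
  qed auto
  with dim show False by simp
qed


section \<open>The orbit homoclinic to the point \<open>(1/3, 2/3)\<close>\<close>

text \<open>\<open>01\<dots>01\<close> (\<open>k\<close> times), then \<open>0011\<close>, then \<open>0101\<dots>\<close>\<close>

definition defect :: "nat \<Rightarrow> nat \<Rightarrow> bool" where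
  "defect k i \<longleftrightarrow> odd i \<noteq> (i = 2 * k + 1 \<or> i = 2 * k + 2)"

lemma dval_odd: "dval odd = 1/3"
proof -
  have "dval odd = (1 + dval odd) / 4"
    by (subst dval_step, subst dval_step) simp
  then show ?thesis by simp
qed

lemma dval_even: "dval even = 2/3"
  using dval_not[of odd] dval_odd by simp

text \<open>For k = 0 the value is (3 + 1/3) / 16 = 5/24. Each further prefix 01 applies x -> (1 +
  x) / 4, which fixes 1/3 and maps [5/24, 1/3] into itself.\<close>

lemma dval_defect: "5/24 \<le> dval (defect k) \<and> dval (defect k) \<le> 1/3"
proof (induction k)
  case 0
  have "(\<lambda>n. defect 0 (Suc (Suc (Suc (Suc n))))) = odd"
    by (auto simp: defect_def fun_eq_iff)
  then have "dval (\<lambda>n. defect 0 (Suc (Suc (Suc (Suc n))))) = 1/3"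
    using dval_odd by simp
  moreover have "dval (defect 0) = (3 + dval (\<lambda>n. defect 0 (Suc (Suc (Suc (Suc n)))))) / 16"
    by (subst dval_step, subst dval_step, subst dval_step, subst dval_step) (simp add: defect_def)
  ultimately show ?case by simp
next
  case (Suc k)
  have "(\<lambda>n. defect (Suc k) (Suc (Suc n))) = defect k"
    by (auto simp: defect_def fun_eq_iff)
  moreover have "dval (defect (Suc k)) = (1 + dval (\<lambda>n. defect (Suc k) (Suc (Suc n)))) / 4"
    by (subst dval_step, subst dval_step) (simp add: defect_def)
  ultimately show ?case using Suc by simp
qed

text \<open>In a concatenation of words (01)^j 0011 (01)^k, each 1.0 sees at most one nearby defect.
  A defect on the right gives a point near the horizontal segment, one on the left a point near the
  vertical segment.\<close>

lemma homoclinic_segment: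
  assumes box: "H \<subseteq> {0<..<1/2} \<times> {1/2<..<1}" and dim: "hausdorff_dim (survivor H) = 0"
  shows "({5/24..1/3} \<times> {2/3} \<union> {1/3} \<times> {2/3..19/24}) \<inter> closure H \<noteq> {}"
    (is "?S \<inter> _ \<noteq> _")
proof
  assume disj: "?S \<inter> closure H = {}"
  have "compact ?S" by (intro compact_Un compact_Times) auto
  \<comment> \<open>The length 4 N + 6 is even, so the alternation keeps its phase across block
    boundaries; flipping two adjacent digits at an odd place turns 0101 into 0011.\<close>
  note * = survivor_near_compact_dim[OF box this disj, where L = "\<lambda>N. 4 * N + 6" and
      w = "\<lambda>N c r. odd r \<noteq> (r = 2 * N + 2 * of_bool c + 1 \<or> r = 2 * N + 2 * of_bool c + 2)"]
  have "hausdorff_dim (survivor H) \<noteq> 0"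
  proof (rule *)
    fix N :: nat
    let ?w = "\<lambda>c r. odd r \<noteq> (r = 2 * N + 2 * of_bool c + 1 \<or> r = 2 * N + 2 * of_bool c + 2)"
    show "\<exists>r<4*N+6. ?w True r \<noteq> ?w False r"
      by (rule exI[of _ "2 * N + 1"]) auto
    show "\<exists>r<4*N+6. \<not> ?w c r" for c
      by (rule exI[of _ 0]) auto
    fix b :: "int \<Rightarrow> bool" and n u
    assume u: "u = blocks (4 * N + 6) ?w b" and un: "u n" "\<not> u (n + 1)"
    obtain q r where qr: "n = int (4 * N + 6) * q + int r" "r < 4 * N + 6"
      using block_pos[of "4 * N + 6"] by (metis add_gr_0 zero_less_numeral)
    define d where "d i = 2 * N + 2 * of_bool (b i)" for i
    have d: "2 * N \<le> d i" "d i \<le> 2 * N + 2" "even (d i)" for i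
      by (auto simp: d_def)
    have at: "u k = (odd r' \<noteq> (r' = d i + 1 \<or> r' = d i + 2))"
      if "k = int (4 * N + 6) * i + int r'" "r' < 4 * N + 6" for k i r'
      unfolding u d_def by (rule blocks_at[OF that])
    \<comment> \<open>The 1 at the even place d q + 2 is followed by a 1, so each 1.0 has its 1 at
      an odd place that is not flipped.\<close>
    have r: "odd r" "r \<noteq> d q + 1"
    proof -
      have "r \<noteq> d q + 2"
        using at[of "n + 1" q "r + 1"] d[of q] un qr by auto
      then show "odd r" "r \<noteq> d q + 1" using at[OF qr] un d[of q] by auto
    qed
    show "\<exists>f g. (dval f, dval g) \<in> ?S \<and> (\<forall>i<N. u (n + 1 + int i) = f i \<and> u (n - int i) = g i)"
    proof (cases "r < d q + 1")
      case True
      obtain k where k: "d q = r + 2 * k + 1"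
      proof -
        have "r < d q" using True r d[of q] by (metis less_Suc_eq Suc_eq_plus1)
        moreover have "even (d q - r - 1)" using r d(3)[of q] calculation by simp
        ultimately show ?thesis using that[of "(d q - r - 1) div 2"] by fastforce
      qed
      show ?thesis
      proof (intro exI conjI allI impI)
        show "(dval (defect k), dval even) \<in> ?S" using dval_defect[of k] dval_even by auto
        fix i assume i: "i < N"
        have "r + 1 + i < 4 * N + 6" using i k d[of q] by linarith
        then show "u (n + 1 + int i) = defect k i"
          using at[of "n + 1 + int i" q "r + 1 + i"] qr(1) r k by (auto simp: defect_def)
        show "u (n - int i) = even i"
        proof (cases "i \<le> r")
          case True
          then show ?thesis
            using at[of "n - int i" q "r - i"] qr r k by (auto simp: of_nat_diff)
        next
          \<comment> \<open>The window runs into the previous block, but its \<open>N\<close> digits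
            do not reach back to that block's defect, which ends no later than place 2 N +
            4.\<close>
          case False
          then show ?thesis
            using at[of "n - int i" "q - 1" "4 * N + 6 + r - i"] qr r i d[of "q - 1"]
            by (auto simp: of_nat_diff algebra_simps)
        qed
      qed
    next
      case False
      obtain k where k: "r = d q + 2 * k + 3"
      proof -
        have gt: "r > d q + 2" using False r d(3)[of q]
          by (metis Suc_eq_plus1 add_2_eq_Suc' even_Suc linorder_neqE_nat not_less_eq)
        then have "even (r - d q - 3)" using r d(3)[of q] by simp
        then show ?thesis using gt that[of "(r - d q - 3) div 2"] by fastforce
      qed
      show ?thesis
      proof (intro exI conjI allI impI)
        \<comment> \<open>Read backwards, 0011 surrounded by 01 is the complement of the same
          pattern, so the second coordinate is 1 - \<open>dval (defect k)\<close>, between 2/3 and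
          19/24.\<close>
        show "(dval odd, dval (\<lambda>i. \<not> defect k i)) \<in> ?S"
          using dval_defect[of k] dval_odd by (auto simp: dval_not)
        fix i assume i: "i < N"
        have ir: "i \<le> r" "r - i < 4 * N + 6" using i k d[of q] qr(2) by linarith+
        have "u (n - int i) = (odd (r - i) \<noteq> (r - i = d q + 1 \<or> r - i = d q + 2))"
          using ir by (intro at) (auto simp: qr(1) of_nat_diff)
        also have "\<dots> = (\<not> defect k i)"
          using ir r k by (auto simp: defect_def)
        finally show "u (n - int i) = (\<not> defect k i)" .
        show "u (n + 1 + int i) = odd i"
        proof (cases "r + 1 + i < 4 * N + 6")
          case True
          then show ?thesis
            using at[of "n + 1 + int i" q "r + 1 + i"] qr r k by auto
        next
          \<comment> \<open>The window enters the next block by fewer than \<open>N\<close> digits,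
            while its defect begins no earlier than place 2 N + 1.\<close>
          case False
          then show ?thesis
            using at[of "n + 1 + int i" "q + 1" "r + 1 + i - (4 * N + 6)"] qr r i d[of "q + 1"]
            by (auto simp: of_nat_diff algebra_simps)
        qed
      qed
    qed
  qed auto
  with dim show False by simp
qed


section \<open>Convexity\<close>

text \<open>The hull lies in the closed box; passing to interiors gives the strict bounds that
  \<open>bpi_shift_in_box\<close> needs.\<close>

lemma Delta_subset_box: "Delta \<subseteq> {0<..<1/2} \<times> {1/2<..<1}"
proof -
  have "convex hull {(0, 1), (1/2, 1), (1/3, 2/3), (0, 1/2)} \<subseteq> {0..1/2::real} \<times> {1/2..1::real}"
    by (rule hull_minimal) (auto intro: convex_Times)
  from interior_mono[OF this] show ?thesis
    unfolding Delta_def by (simp add: interior_Times)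
qed

text \<open>Taking the closure of a convex set does not enlarge its interior, so the corners need
  only be limit points of \<open>S\<close>.\<close>

lemma interior_hull_subset:
  fixes S :: "'a::euclidean_space set"
  assumes "open S" "convex S" "V \<subseteq> closure S"
  shows "interior (convex hull V) \<subseteq> S"
proof -
  have "convex hull V \<subseteq> closure S"
    using assms by (intro hull_minimal convex_closure)
  then show ?thesis
    using interior_mono[of "convex hull V" "closure S"] convex_interior_closure[OF assms(2)] assms(1)
    by (simp add: interior_open)
qed

theorem theorem3p5:
  fixes \<Delta>\<^sub>0 :: "(real \<times> real) set"
  assumes "\<Delta>\<^sub>0 \<subseteq> Delta"
    and "open \<Delta>\<^sub>0"
    and "convex \<Delta>\<^sub>0"
    and "dimension_trap \<Delta>\<^sub>0"
  shows "Delta' \<subseteq> \<Delta>\<^sub>0 \<or> Delta'' \<subseteq> \<Delta>\<^sub>0"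
proof -
  let ?C = "closure \<Delta>\<^sub>0"
  have box: "\<Delta>\<^sub>0 \<subseteq> {0<..<1/2} \<times> {1/2<..<1}" using assms(1) Delta_subset_box by blast
  have dim: "hausdorff_dim (survivor \<Delta>\<^sub>0) = 0" using assms(4) by (simp add: dimension_trap_def)
  have conv: "convex ?C" using assms(3) by (rule convex_closure)
  note corners = corner_0_1[OF box dim] corner_0_half[OF box dim] corner_half_1[OF box dim]
  \<comment> \<open>The edge joining the corners (0,1/2) and (1/2,1), with weight 2 t on the
    latter.\<close>
  have diag: "(t, t + 1/2) \<in> ?C" if "0 \<le> t" "t \<le> 1/2" for t
    using convexD_alt[OF conv corners(2,3), of "2 * t"] that by (simp add: field_simps)
  have "(5/24, 2/3) \<in> ?C \<or> (1/3, 19/24) \<in> ?C"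
  proof -
    from homoclinic_segment[OF box dim] consider
      x where "5/24 \<le> x" "x \<le> 1/3" "(x, 2/3) \<in> ?C" | y where "2/3 \<le> y" "y \<le> 19/24" "(1/3, y) \<in> ?C"
      by auto
    then show ?thesis
    proof cases
      case 1
      have "(1/6, 2/3) \<in> ?C" using diag[of "1/6"] by simp
      \<comment> \<open>The weight with which (5/24,2/3) divides the horizontal segment from the
        edge point (1/6,2/3) to (x,2/3); 1/24 = 5/24 - 1/6.\<close>
      moreover define l where "l = (1/24) / (x - 1/6)"
      moreover have "0 \<le> l" "l \<le> 1" using 1 by (auto simp: l_def)
      ultimately have "(1 - l) *\<^sub>R (1/6, 2/3) + l *\<^sub>R (x, 2/3) \<in> ?C"
        using 1 by (intro convexD_alt[OF conv]) auto
      moreover have "l * (x - 1/6) = 1/24" using 1 by (simp add: l_def)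
      then have "(1 - l) * (1/6) + l * x = 5/24" "(1 - l) * (2/3) + l * (2/3) = 2/3" by argo+
      ultimately have "(5/24, 2/3) \<in> ?C" by (simp only: scaleR_Pair add_Pair real_scaleR_def)
      then show ?thesis ..
    next
      case 2
      have "(1/3, 5/6) \<in> ?C" using diag[of "1/3"] by simp
      \<comment> \<open>The same on the vertical line, from the edge point (1/3,5/6) down to
        (1/3,y); 1/24 = 5/6 - 19/24.\<close>
      moreover define l where "l = (1/24) / (5/6 - y)"
      moreover have "0 \<le> l" "l \<le> 1" using 2 by (auto simp: l_def)
      ultimately have "(1 - l) *\<^sub>R (1/3, 5/6) + l *\<^sub>R (1/3, y) \<in> ?C"
        using 2 by (intro convexD_alt[OF conv]) auto
      moreover have "l * (5/6 - y) = 1/24" using 2 by (simp add: l_def)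
      then have "(1 - l) * (5/6) + l * y = 19/24" "(1 - l) * (1/3) + l * (1/3) = 1/3" by argo+
      ultimately have "(1/3, 19/24) \<in> ?C" by (simp only: scaleR_Pair add_Pair real_scaleR_def)
      then show ?thesis ..
    qed
  qed
  then show ?thesis
    unfolding Delta'_def Delta''_def using corners
    by (auto intro!: interior_hull_subset[OF assms(2,3)])
qed

end
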